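(* Let $q$ be a prime power and let $G$ be a finite directed or undirected graph with vertex set $\{1,\dots,n\}$, $n\ge 1$. If there exists a nonempty RDSS code $\mathcal{C}$ over $\mathbb{F}_q$ of dimension $k$ for the distributed storage graph $G$, then there exists an index code over $\mathbb{F}_q$ for the side information graph $G$ of length $$\Big\lceil\, n-k+\log_q\min\{n\ln q,\;1+k\ln q\}\,\Big\rceil .$$
   Context: For a vertex $i$ of $G(V,E)$, $V=\{1,\dots,n\}$, let $N(i)=\{u\in V:(i,u)\in E\}$. For $X\in\mathbb{F}_q^n$ and $I\subseteq V$, $X_I\in\mathbb{F}_q^{|I|}$ denotes the projection onto the coordinates in $I$. An RDSS (recoverable distributed storage system) code for $G$ is a set $\mathcal{C}\subseteq\mathbb{F}_q^n$ for which there are deterministic functions $f_i:\mathbb{F}_q^{|N(i)|}\to\mathbb{F}_q$, $i=1,\dots,n$, with $X_i=f_i(X_{N(i)})$ for all $X\in\mathcal{C}$ and all $i$. Its dimension is $k=\log_q|\mathcal{C}|$ (not necessarily an integer). An index code of length $\ell$ (a nonnegative integer) over $\mathbb{F}_q$ with side information graph $G$ consists of an encoding function $f:\mathbb{F}_q^n\to\mathbb{F}_q^\ell$ and deterministic decoding functions $g_1,\dots,g_n$ with $g_i(f(Y),Y_{N(i)})=Y_i$ for all $Y=(Y_1,\dots,Y_n)\in\mathbb{F}_q^n$ and all $i$. *)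

theory Defs
  imports Complex_Main "HOL-Library.FuncSet" "HOL-Library.Cardinality" "Graph_Theory.Pair_Digraph"
begin

(* The space F^I for an index set I, where F is the finite field 'a: functions on I, extended
   by undefined outside I so that they are determined by their coordinates in I.
   F_q^n is vectors {1..n}, and the projection X_I is restrict X I, a member of vectors I. *)
definition vectors :: "nat set \<Rightarrow> (nat \<Rightarrow> 'a::{field,finite}) set" where
  "vectors I = I \<rightarrow>\<^sub>E UNIV"

(* An undirected graph is represented by a symmetric arc relation. *)
definition nbhd :: "nat pair_pre_digraph \<Rightarrow> nat \<Rightarrow> nat set" where
  "nbhd G i = {u \<in> pverts G. (i, u) \<in> parcs G}"

definition rdss_code ::
    "nat pair_pre_digraph \<Rightarrow> (nat \<Rightarrow> 'a::{field,finite}) set \<Rightarrow> bool" where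
  "rdss_code G C \<longleftrightarrow>
     C \<subseteq> vectors (pverts G) \<and>
     (\<exists>f :: nat \<Rightarrow> (nat \<Rightarrow> 'a) \<Rightarrow> 'a.
        \<forall>X\<in>C. \<forall>i\<in>pverts G. X i = f i (restrict X (nbhd G i)))"

definition code_dimension :: "(nat \<Rightarrow> 'a::{field,finite}) set \<Rightarrow> real" where
  "code_dimension C = log (real CARD('a)) (real (card C))"

definition index_code ::
    "nat pair_pre_digraph \<Rightarrow> nat \<Rightarrow> ((nat \<Rightarrow> 'a::{field,finite}) \<Rightarrow> (nat \<Rightarrow> 'a))
      \<Rightarrow> (nat \<Rightarrow> (nat \<Rightarrow> 'a) \<Rightarrow> (nat \<Rightarrow> 'a) \<Rightarrow> 'a) \<Rightarrow> bool" where
  "index_code G l f g \<longleftrightarrow>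
     f \<in> vectors (pverts G) \<rightarrow> vectors {1..l} \<and>
     (\<forall>Y\<in>vectors (pverts G). \<forall>i\<in>pverts G. g i (f Y) (restrict Y (nbhd G i)) = Y i)"

end

theory Submission
  imports Defs
begin

(* If Y - a lies in C, then the recovery functions of C, applied to the translated side
   information, return Y from a; so it suffices to transmit a. An index code of length l
   therefore exists as soon as q^l translates of C cover F_q^n. By averaging, some translate
   covers at least the fraction |C| / q^n of any given set of vectors, so t greedily chosen
   translates leave at most q^n (1 - |C| / q^n)^t vectors uncovered. This is less than 1 for
   t >= (q^n / |C|) n ln q; alternatively, after (q^n / |C|) ln |C| steps at most q^n / |C|
   vectors remain, and each gets a translate of its own. *)

section \<open>Vectors and their translates\<close>

lemma card_vectors:
  assumes "finite I"
  shows "card (vectors I :: (nat \<Rightarrow> 'a::{field,finite}) set) = CARD('a) ^ card I"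
  using assms by (simp add: vectors_def card_PiE)

lemma finite_vectors: "finite I \<Longrightarrow> finite (vectors I :: (nat \<Rightarrow> 'a::{field,finite}) set)"
  by (simp add: vectors_def finite_PiE)

definition translate :: "nat set \<Rightarrow> (nat \<Rightarrow> 'a) \<Rightarrow> (nat \<Rightarrow> 'a) \<Rightarrow> nat \<Rightarrow> 'a::{field,finite}" where
  "translate I a Y = (\<lambda>i\<in>I. Y i - a i)"

lemma translate_in_vectors: "translate I a Y \<in> vectors I"
  by (simp add: translate_def vectors_def)

text \<open>Y - (Y - a) = a, so for fixed \<open>Y\<close> the map sending a to Y - a is an
  involution on \<open>vectors I\<close>.\<close>

lemma translate_translate:
  assumes "a \<in> vectors I"
  shows "translate I (translate I a Y) Y = a"
  using assms by (auto simp: translate_def vectors_def fun_eq_iff PiE_def extensional_def)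

text \<open>The involution exchanges these translations with the codewords. The count does not
  depend on \<open>Y\<close>, which is the regularity that the covering argument requires.\<close>

lemma card_translations_into:
  assumes "C \<subseteq> vectors I"
  shows "card {a \<in> vectors I. translate I a Y \<in> C} = card C"
proof -
  have "bij_betw (\<lambda>a. translate I a Y) {a \<in> vectors I. translate I a Y \<in> C} C"
    by (rule bij_betw_byWitness[where f' = "\<lambda>X. translate I X Y"])
      (use assms in \<open>auto simp: translate_translate translate_in_vectors subset_iff\<close>)
  then show ?thesis
    by (rule bij_betw_same_card)
qed

subsection \<open>Greedy covering\<close>

text \<open>Double counting of the pairs related by \<open>R\<close>: an average element of
  \<open>A\<close> is related to \<open>card U * c / card A\<close> elements of \<open>U\<close>,
  and some element reaches the average. The inequality is multiplied out to stay in the natural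
  numbers.\<close>

lemma exists_above_average:
  fixes R :: "'b \<Rightarrow> 'c \<Rightarrow> bool"
  assumes "finite A" "A \<noteq> {}" "finite U"
    and deg: "\<And>y. y \<in> U \<Longrightarrow> card {a \<in> A. R a y} = c"
  shows "\<exists>a\<in>A. card U * c \<le> card A * card {y \<in> U. R a y}"
proof (rule ccontr)
  assume "\<not> ?thesis"
  then have "(\<Sum>a\<in>A. card A * card {y \<in> U. R a y}) < (\<Sum>a\<in>A. card U * c)"
    using assms by (intro sum_strict_mono) auto
  moreover have "(\<Sum>a\<in>A. card {y \<in> U. R a y}) = c * card U"
    using sum_multicount[of A U R c] assms by simp
  ultimately show False
    by (simp add: sum_distrib_left[symmetric])
qed

text \<open>Each step applies the averaging to the uncovered set \<open>W\<close>. Degrees count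
  elements of \<open>A\<close>, so they are still \<open>c\<close> on \<open>W\<close>, and the same
  factor is gained every time. A choice may repeat, hence only
  \<open>card B \<le> t\<close>.\<close>

lemma greedy_partial_cover:
  fixes R :: "'b \<Rightarrow> 'c \<Rightarrow> bool"
  assumes "finite A" "A \<noteq> {}" "finite U"
    and deg: "\<And>y. y \<in> U \<Longrightarrow> card {a \<in> A. R a y} = c"
    and "c \<le> card A"
  shows "\<exists>B\<subseteq>A. card B \<le> t \<and>
    real (card {y \<in> U. \<forall>a\<in>B. \<not> R a y}) \<le> real (card U) * (1 - real c / real (card A)) ^ t"
proof (induction t)
  case 0
  show ?case
    by (intro exI[of _ "{}"]) simp
next
  case (Suc t)
  let ?r = "1 - real c / real (card A)"
  obtain B where B: "B \<subseteq> A" "card B \<le> t"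
    and rest: "real (card {y \<in> U. \<forall>a\<in>B. \<not> R a y}) \<le> real (card U) * ?r ^ t"
    using Suc by blast
  define W where "W = {y \<in> U. \<forall>a\<in>B. \<not> R a y}"
  have "finite W" "W \<subseteq> U"
    using \<open>finite U\<close> by (auto simp: W_def)
  have A: "0 < card A"
    using assms by (simp add: card_gt_0_iff)
  obtain a where a: "a \<in> A" "card W * c \<le> card A * card {y \<in> W. R a y}"
    using exists_above_average[of A W R c] assms \<open>finite W\<close> \<open>W \<subseteq> U\<close> by blast
  have "card {y \<in> W. R a y} + card {y \<in> W. \<not> R a y} = card W"
    using \<open>finite W\<close> by (subst card_Un_disjoint[symmetric]) (auto intro: arg_cong[where f = card])
  then have split: "real (card {y \<in> W. \<not> R a y}) = real (card W) - real (card {y \<in> W. R a y})"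
    by linarith
  have "real (card W) * real c \<le> real (card A) * real (card {y \<in> W. R a y})"
    using a(2) by (metis of_nat_le_iff of_nat_mult)
  then have "real (card {y \<in> W. \<not> R a y}) \<le> real (card W) * ?r"
    using A unfolding split by (simp add: field_simps)
  also have "\<dots> \<le> real (card U) * ?r ^ t * ?r"
    using rest \<open>c \<le> card A\<close> A by (intro mult_right_mono) (auto simp: W_def)
  also have "\<dots> = real (card U) * ?r ^ Suc t"
    by (simp add: mult_ac)
  also have "{y \<in> W. \<not> R a y} = {y \<in> U. \<forall>b\<in>insert a B. \<not> R b y}"
    by (auto simp: W_def)
  finally have "real (card {y \<in> U. \<forall>b\<in>insert a B. \<not> R b y}) \<le> real (card U) * ?r ^ Suc t" .
  moreover have "card (insert a B) \<le> Suc t"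
    using B(2) finite_subset[OF B(1) \<open>finite A\<close>] by (simp add: card_insert_if)
  ultimately show ?case
    using B(1) a(1) by (intro exI[of _ "insert a B"] conjI insert_subsetI)
qed

text \<open>The case split follows the smaller term of the \<open>min\<close>. For
  \<open>N = 1\<close> the bound alone would admit \<open>M = 0\<close>, where no cover exists;
  \<open>0 < M\<close> excludes this.\<close>

lemma regular_cover:
  fixes R :: "'b \<Rightarrow> 'c \<Rightarrow> bool"
  assumes "finite A" "finite U" "card A = N" "card U = N" "0 < N"
    and deg: "\<And>y. y \<in> U \<Longrightarrow> card {a \<in> A. R a y} = c"
    and "0 < c" "0 < M"
    and M: "real N / real c * min (ln (real N)) (1 + ln (real c)) \<le> real M"
  shows "\<exists>B\<subseteq>A. card B \<le> M \<and> (\<forall>y\<in>U. \<exists>a\<in>B. R a y)"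
proof -
  let ?r = "1 - real c / real N"
  have ne: "A \<noteq> {}" "U \<noteq> {}"
    using assms by auto
  then obtain y where "y \<in> U"
    by blast
  then have "c \<le> N"
    using card_mono[of A "{a \<in> A. R a y}"] deg assms by auto
  then have r: "0 \<le> ?r"
    using \<open>0 < N\<close> by simp
  have cN: "0 < real c / real N"
    using assms by simp
  have partial: "\<exists>B\<subseteq>A. card B \<le> t \<and>
    real (card {y \<in> U. \<forall>a\<in>B. \<not> R a y}) \<le> real N * ?r ^ t" for t
    using greedy_partial_cover[of A U R c t] assms ne \<open>c \<le> N\<close> by simp
  show ?thesis
  proof (cases "ln (real N) \<le> 1 + ln (real c)")
    case True
    obtain B where B: "B \<subseteq> A" "card B \<le> M"
      and rest: "real (card {y \<in> U. \<forall>a\<in>B. \<not> R a y}) \<le> real N * ?r ^ M"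
      using partial by blast
    \<comment> \<open>Strictness is essential: the uncovered number must end up below 1, not merely
      at most 1.\<close>
    have "?r < exp (- (real c / real N))"
      using cN by (intro exp_minus_greater[THEN iffD2]) linarith
    then have "?r ^ M < exp (- (real c / real N)) ^ M"
      using r \<open>0 < M\<close> by (intro power_strict_mono) auto
    also have "\<dots> = exp (- (real M * (real c / real N)))"
      by (simp add: exp_of_nat_mult[symmetric])
    also have "\<dots> \<le> exp (- ln (real N))"
      using M True \<open>0 < c\<close> \<open>0 < N\<close> by (simp add: field_simps)
    also have "\<dots> = 1 / real N"
      using \<open>0 < N\<close> by (simp add: exp_minus inverse_eq_divide)
    finally have "real N * ?r ^ M < 1"
      using \<open>0 < N\<close> by (simp add: field_simps)
    with rest have "card {y \<in> U. \<forall>a\<in>B. \<not> R a y} = 0"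
      by linarith
    moreover have "finite {y \<in> U. \<forall>a\<in>B. \<not> R a y}"
      using \<open>finite U\<close> by simp
    ultimately have "{y \<in> U. \<forall>a\<in>B. \<not> R a y} = {}"
      by (simp only: card_0_eq)
    then have "\<forall>y\<in>U. \<exists>a\<in>B. R a y"
      by blast
    with B show ?thesis
      by (intro exI[of _ B] conjI)
  next
    case False
    \<comment> \<open>Chosen so that N exp(-s c / N) = N / c: from here on, covering the remaining
      elements one by one costs at most N / c.\<close>
    define s where "s = real N / real c * ln (real c)"
    define t where "t = nat \<lceil>s\<rceil>"
    have "0 \<le> s"
      using \<open>0 < c\<close> by (simp add: s_def)
    then have t: "s \<le> real t" "real t < s + 1"
      unfolding t_def by linarith+
    obtain B where B: "B \<subseteq> A" "card B \<le> t"
      and rest: "real (card {y \<in> U. \<forall>a\<in>B. \<not> R a y}) \<le> real N * ?r ^ t"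
      using partial by blast
    define W where "W = {y \<in> U. \<forall>a\<in>B. \<not> R a y}"
    have "?r \<le> exp (- (real c / real N))"
      using exp_ge_add_one_self[of "- (real c / real N)"] by simp
    then have "?r ^ t \<le> exp (- (real c / real N)) ^ t"
      using r by (intro power_mono) auto
    also have "\<dots> = exp (- (real t * (real c / real N)))"
      by (simp add: exp_of_nat_mult[symmetric])
    also have "\<dots> \<le> exp (- ln (real c))"
      using t(1) \<open>0 < c\<close> \<open>0 < N\<close> by (simp add: s_def field_simps)
    also have "\<dots> = 1 / real c"
      using \<open>0 < c\<close> by (simp add: exp_minus inverse_eq_divide)
    finally have "real N * ?r ^ t \<le> real N * (1 / real c)"
      by (intro mult_left_mono) auto
    with rest have W: "real (card W) \<le> real N / real c"
      by (simp add: W_def)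
    \<comment> \<open>An individual choice for each leftover element; it exists because
      \<open>0 < c\<close>.\<close>
    define h where "h y = (SOME a. a \<in> A \<and> R a y)" for y
    have h: "h y \<in> A \<and> R (h y) y" if "y \<in> U" for y
    proof -
      have "card {a \<in> A. R a y} \<noteq> 0"
        using deg[OF that] \<open>0 < c\<close> by simp
      then have "{a \<in> A. R a y} \<noteq> {}"
        by (rule contrapos_nn) (simp only: card.empty)
      then show ?thesis
        unfolding h_def by (intro someI_ex[where P = "\<lambda>a. a \<in> A \<and> R a y"]) blast
    qed
    have "card (B \<union> h ` W) \<le> card B + card W"
      using card_Un_le[of B "h ` W"] card_image_le[of W h] \<open>finite U\<close> by (simp add: W_def)
    also have "\<dots> \<le> t + card W"
      using B(2) by simp
    also have "\<dots> \<le> M"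
    proof -
      have "s + real N / real c \<le> real M"
        using M False by (simp add: s_def distrib_left)
      \<comment> \<open>Rounding \<open>s\<close> up to \<open>t\<close> costs less than 1, which
        the integrality of both sides absorbs.\<close>
      then have "real (t + card W) < real M + 1"
        using t(2) W by simp
      then show ?thesis
        by linarith
    qed
    finally have "card (B \<union> h ` W) \<le> M" .
    moreover have "\<forall>y\<in>U. \<exists>a\<in>B \<union> h ` W. R a y"
      using h by (auto simp: W_def)
    moreover have "B \<union> h ` W \<subseteq> A"
      using B(1) h by (auto simp: W_def)
    ultimately show ?thesis
      by (intro exI[of _ "B \<union> h ` W"] conjI)
  qed
qed

subsection \<open>Index codes from coverings\<close>

text \<open>The encoder sends a label of some a in \<open>B\<close> with Y - a in \<open>C\<close>.
  Receiver i subtracts a from its side information, recovers coordinate i of Y - a with the recovery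
  function of \<open>C\<close>, and adds a back.\<close>

lemma index_code_of_cover:
  fixes C :: "(nat \<Rightarrow> 'a::{field,finite}) set"
  assumes C: "rdss_code G C"
    and "finite B" "card B \<le> CARD('a) ^ l"
    and cover: "\<And>Y. Y \<in> vectors (pverts G) \<Longrightarrow> \<exists>a\<in>B. translate (pverts G) a Y \<in> C"
  shows "\<exists>f g. index_code G l (f :: (nat \<Rightarrow> 'a) \<Rightarrow> nat \<Rightarrow> 'a) g"
proof -
  let ?V = "pverts G"
  obtain F where F: "\<And>X i. X \<in> C \<Longrightarrow> i \<in> ?V \<Longrightarrow> X i = F i (restrict X (nbhd G i))"
    using C unfolding rdss_code_def by metis
  have "card B \<le> card (vectors {1..l} :: (nat \<Rightarrow> 'a) set)"
    using assms by (simp add: card_vectors)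
  \<comment> \<open>\<open>h\<close> labels the elements of \<open>B\<close> by distinct words of
    length \<open>l\<close>; \<open>inv_into B h\<close> reads the labels.\<close>
  then obtain h :: "(nat \<Rightarrow> 'a) \<Rightarrow> nat \<Rightarrow> 'a" where h: "h ` B \<subseteq> vectors {1..l}" "inj_on h B"
    using card_le_inj[of B "vectors {1..l} :: (nat \<Rightarrow> 'a) set"] \<open>finite B\<close>
      finite_vectors[of "{1..l}"] by blast
  obtain b where b: "\<And>Y. Y \<in> vectors ?V \<Longrightarrow> b Y \<in> B \<and> translate ?V (b Y) Y \<in> C"
    using cover by metis
  define g where "g i s z = inv_into B h s i + F i (\<lambda>j\<in>nbhd G i. z j - inv_into B h s j)" for i s z
  have "g i (h (b Y)) (restrict Y (nbhd G i)) = Y i" if "Y \<in> vectors ?V" "i \<in> ?V" for Y i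
  proof -
    \<comment> \<open>Since \<open>nbhd G i\<close> lies within the vertex set, every coordinate
      used here is a genuine difference.\<close>
    have "restrict (translate ?V (b Y) Y) (nbhd G i) = (\<lambda>j\<in>nbhd G i. restrict Y (nbhd G i) j - b Y j)"
      by (auto simp: translate_def nbhd_def fun_eq_iff)
    with F[of "translate ?V (b Y) Y" i] b that
    have "Y i - b Y i = F i (\<lambda>j\<in>nbhd G i. restrict Y (nbhd G i) j - b Y j)"
      by (simp add: translate_def)
    moreover have "inv_into B h (h (b Y)) = b Y"
      using h(2) b that by simp
    ultimately show ?thesis
      unfolding g_def by (metis add.commute diff_add_cancel)
  qed
  then have "index_code G l (\<lambda>Y. h (b Y)) g"
    using h(1) b by (auto simp: index_code_def)
  then show ?thesis
    by blast
qed

text \<open>From ln y < y - 1 at y = 1/x one gets ln x > 1 - 1/x, and this is at least 1/x for x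
  \<ge> 2. It serves to keep the code length nonnegative.\<close>

lemma inverse_less_ln:
  assumes "2 \<le> (x::real)"
  shows "1 / x < ln x"
proof -
  have "ln (1 / x) < 1 / x - 1"
    using assms ln_le_minus_one[of "1 / x"] ln_eq_minus_one[of "1 / x"] by fastforce
  then have "1 - 1 / x < ln x"
    using assms by (simp add: ln_div)
  moreover have "1 / x \<le> 1 - 1 / x"
    using assms by (simp add: field_simps)
  ultimately show ?thesis
    by linarith
qed

theorem lemma4:
  fixes G :: "nat pair_pre_digraph"
    and C :: "(nat \<Rightarrow> 'a::{field,finite}) set"
    and n q :: nat
    and k :: real
  assumes "CARD('a) = q"
    and "n \<ge> 1"
    and "pair_fin_digraph G"
    and "pverts G = {1..n}"
    and "rdss_code G C"
    and "C \<noteq> {}"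
    and "code_dimension C = k"
  shows "\<exists>(l::nat) (f :: (nat \<Rightarrow> 'a) \<Rightarrow> (nat \<Rightarrow> 'a)) g.
           int l = \<lceil>real n - k + log (real q) (min (real n * ln (real q)) (1 + k * ln (real q)))\<rceil> \<and>
           index_code G l f g"
proof -
  let ?V = "vectors {1..n} :: (nat \<Rightarrow> 'a) set"
  let ?m = "min (real n * ln (real q)) (1 + k * ln (real q))"
  let ?x = "real n - k + log (real q) ?m"
  define c where "c = card C"
  have "C \<subseteq> ?V"
    using assms by (simp add: rdss_code_def)
  have finV: "finite ?V" and cardV: "card ?V = q ^ n"
    using assms by (simp_all add: finite_vectors card_vectors)
  have "card {0, 1 :: 'a} \<le> CARD('a)"
    by (intro card_mono) auto
  then have q: "2 \<le> q"
    using assms by simp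
  have "0 < c"
    unfolding c_def using \<open>C \<subseteq> ?V\<close> finV assms(6) by (simp add: card_gt_0_iff finite_subset)
  have "c \<le> q ^ n"
    unfolding c_def using card_mono[OF finV \<open>C \<subseteq> ?V\<close>] cardV by simp
  have k: "k = log (real q) (real c)"
    using assms by (simp add: code_dimension_def c_def)
  have lnc: "k * ln (real q) = ln (real c)"
    using q by (simp add: k log_def)
  have "0 \<le> k"
    using q \<open>0 < c\<close> by (simp add: k)
  have "real c \<le> real q ^ n"
    using \<open>c \<le> q ^ n\<close> by (metis of_nat_le_iff of_nat_power)
  then have "k \<le> real n"
    using q \<open>0 < c\<close> unfolding k by (intro log_of_power_le) auto
  \<comment> \<open>Both terms of the minimum exceed 1/q, so its logarithm exceeds -1. With
    \<open>k \<le> real n\<close> this gives \<open>- 1 < ?x\<close>; hence the ceiling is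
    nonnegative and \<open>nat\<close> does not truncate it.\<close>
  have "1 / real q < ln (real q)"
    using inverse_less_ln[of "real q"] q by simp
  also have "\<dots> \<le> real n * ln (real q)"
    using assms(2) q by (simp add: mult_le_cancel_right1)
  finally have "1 / real q < real n * ln (real q)" .
  moreover have "1 / real q < 1 + k * ln (real q)"
  proof -
    have "1 / real q < 1"
      using q by simp
    moreover have "0 \<le> k * ln (real q)"
      using q \<open>0 \<le> k\<close> by simp
    ultimately show ?thesis
      by linarith
  qed
  ultimately have m: "1 / real q < ?m"
    by simp
  have "0 < ?m"
    using m q by (meson divide_nonneg_nonneg le_less_trans of_nat_0_le_iff zero_le_one)
  have "log (real q) (1 / real q) < log (real q) ?m"
    using m q by (intro log_less) auto
  then have "- 1 < ?x"
    using q \<open>k \<le> real n\<close> by (simp add: log_divide)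
  define l where "l = nat \<lceil>?x\<rceil>"
  have l: "int l = \<lceil>?x\<rceil>"
    using \<open>- 1 < ?x\<close> unfolding l_def by linarith
  \<comment> \<open>The bound of \<open>regular_cover\<close> with N = q^n and M = q^l. As c = q^k,
    the left side is exactly q to the power \<open>?x\<close>, which explains the claimed
    length.\<close>
  have "real (q ^ n) / real c * min (ln (real (q ^ n))) (1 + ln (real c)) \<le> real (q ^ l)"
  proof -
    have "real (q ^ n) / real c * min (ln (real (q ^ n))) (1 + ln (real c)) =
      real q powr real n / real q powr k * real q powr log (real q) ?m"
      using q \<open>0 < c\<close> \<open>0 < ?m\<close> lnc by (simp add: k ln_realpow powr_realpow)
    also have "\<dots> = real q powr ?x"
      by (simp add: powr_add powr_diff)
    also have "\<dots> \<le> real q powr real l"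
      using q unfolding l_def by (intro powr_mono real_nat_ceiling_ge) simp
    also have "\<dots> = real (q ^ l)"
      using q by (simp add: powr_realpow)
    finally show ?thesis .
  qed
  \<comment> \<open>Translations and vectors to be covered both range over \<open>?V\<close>, so the
    two sets have the same size q^n.\<close>
  then have "\<exists>B\<subseteq>?V. card B \<le> q ^ l \<and> (\<forall>Y\<in>?V. \<exists>a\<in>B. translate {1..n} a Y \<in> C)"
    using finV cardV q \<open>0 < c\<close> card_translations_into[OF \<open>C \<subseteq> ?V\<close>]
    by (intro regular_cover[where c = c and N = "q ^ n"]) (auto simp: c_def)
  then obtain B where "B \<subseteq> ?V" "card B \<le> q ^ l"
    and "\<And>Y. Y \<in> ?V \<Longrightarrow> \<exists>a\<in>B. translate {1..n} a Y \<in> C"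
    by blast
  then have "\<exists>f g. index_code G l (f :: (nat \<Rightarrow> 'a) \<Rightarrow> nat \<Rightarrow> 'a) g"
    using index_code_of_cover[OF assms(5), of B l] finV assms by (simp add: finite_subset)
  with l show ?thesis
    by blast
qed

end
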